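(* If $S$ is a semigroup with zero $0$, then the conjugacy class of $0$ with respect to $\sim_c$ is $[0]_c=\{0\}$.
   Context: For a semigroup $S$, $S^1$ is $S$ if $S$ is a monoid, and $S$ with an identity $1$ adjoined otherwise. If $S$ has a zero $0$ and $0\ne a\in S$, let $\mathbb{P}(a)=\{g\in S:(ma)g\neq 0\text{ for all }ma\in S^1a\setminus\{0\}\}$, and $\mathbb{P}(0)=\{0\}$. Put $\mathbb{P}^1(a)=\mathbb{P}(a)\cup\{1\}$. Then $a\sim_c b$ iff there are $g\in\mathbb{P}^1(a)$, $h\in\mathbb{P}^1(b)$ with $ag=gb$ and $bh=ha$. This is an equivalence relation, and $[a]_c$ denotes the class of $a$. *)

theory Defs
  imports Main
begin

text \<open>
  A semigroup with zero is a type of sort \<open>{semigroup_mult, mult_zero}\<close>. The monoid \<open>S\<^sup>1\<close> lives in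
  \<open>'a option\<close>: \<open>Some\<close> embeds \<open>S\<close>, and \<open>None\<close> is the adjoined identity, which belongs to \<open>S\<^sup>1\<close>
  only when \<open>S\<close> has no identity of its own.
\<close>

definition is_identity :: "'a::semigroup_mult \<Rightarrow> bool"
  where "is_identity e \<longleftrightarrow> (\<forall>x. e * x = x \<and> x * e = x)"

definition S1 :: "'a::semigroup_mult option set"
  where "S1 = (if \<exists>e::'a. is_identity e then range Some else insert None (range Some))"

definition one1 :: "'a::semigroup_mult option"
  where "one1 = (if \<exists>e::'a. is_identity e then Some (THE e. is_identity e) else None)"

fun mult1 :: "'a::semigroup_mult option \<Rightarrow> 'a option \<Rightarrow> 'a option" (infixl "\<odot>" 70)
  where
    "None \<odot> y = y"
  | "Some x \<odot> None = Some x"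
  | "Some x \<odot> Some y = Some (x * y)"

lemma is_identity_unique: "is_identity d \<Longrightarrow> is_identity e \<Longrightarrow> d = e"
  unfolding is_identity_def by metis

lemma mult1_assoc: "(x \<odot> y) \<odot> z = x \<odot> (y \<odot> z)"
  by (cases x; cases y; cases z) (simp_all add: mult.assoc)

lemma mult1_closed: "x \<in> S1 \<Longrightarrow> y \<in> S1 \<Longrightarrow> x \<odot> y \<in> S1"
  unfolding S1_def by (cases x; cases y) (auto split: if_splits)

lemma one1_in_S1: "one1 \<in> S1"
  by (simp add: S1_def one1_def)

lemma one1_identity:
  fixes x :: "'a::semigroup_mult option"
  assumes "x \<in> S1"
  shows "one1 \<odot> x = x" and "x \<odot> one1 = x"
proof -
  have "one1 \<odot> x = x \<and> x \<odot> one1 = x"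
  proof (cases "\<exists>e::'a. is_identity e")
    case True
    then obtain e :: 'a where e: "is_identity e" by blast
    then have "(THE d::'a. is_identity d) = e"
      using is_identity_unique by blast
    with True have one: "(one1::'a option) = Some e"
      by (simp add: one1_def)
    from True assms obtain y where "x = Some y"
      by (auto simp: S1_def)
    with e show ?thesis
      unfolding one by (simp add: is_identity_def)
  next
    case False
    then show ?thesis by (cases x) (simp_all add: one1_def)
  qed
  then show "one1 \<odot> x = x" and "x \<odot> one1 = x" by auto
qed

definition PP :: "'a::{semigroup_mult, mult_zero} \<Rightarrow> 'a set"
  where "PP a = (if a = 0 then {0}
    else {g. \<forall>x \<in> (\<lambda>m. m \<odot> Some a) ` S1 - {Some 0}. x \<odot> Some g \<noteq> Some 0})"

definition PP1 :: "'a::{semigroup_mult, mult_zero} \<Rightarrow> 'a option set"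
  where "PP1 a = Some ` PP a \<union> {one1}"

definition conj_c :: "('a::{semigroup_mult, mult_zero} \<times> 'a) set"
  where "conj_c = {(a, b). \<exists>g \<in> PP1 a. \<exists>h \<in> PP1 b.
    Some a \<odot> g = g \<odot> Some b \<and> Some b \<odot> h = h \<odot> Some a}"

definition conj_class :: "'a::{semigroup_mult, mult_zero} \<Rightarrow> 'a set"
  where "conj_class a = conj_c `` {a}"

end

theory Submission
  imports Defs
begin

text \<open>If 0 is conjugate to b, the second equation gives bh = h0 for some h in
  \<open>PP1 b\<close>. For h = 1 this says b = 0; otherwise bh = 0, which is impossible for nonzero
  b by \<open>PP_mult_nonzero\<close>.\<close>

lemma Some_in_S1: "Some x \<in> S1"
  by (simp add: S1_def)

text \<open>Take m = 1 in the condition defining \<open>PP b\<close>: b itself is a nonzero left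
  multiple of b.\<close>

lemma PP_mult_nonzero:
  fixes b :: "'a::{semigroup_mult, mult_zero}"
  assumes "b \<noteq> 0" and "g \<in> PP b"
  shows "b * g \<noteq> 0"
proof -
  have "one1 \<odot> Some b = Some b"
    by (simp add: one1_identity Some_in_S1)
  then have "Some b \<in> (\<lambda>m. m \<odot> Some b) ` S1"
    using one1_in_S1 by (metis imageI)
  with assms have "Some b \<odot> Some g \<noteq> Some 0"
    unfolding PP_def by (metis (mono_tags, lifting) DiffI mem_Collect_eq option.inject singletonD)
  then show ?thesis by simp
qed

lemma PP1_annihilator:
  fixes b :: "'a::{semigroup_mult, mult_zero}"
  assumes "h \<in> PP1 b" and eq: "Some b \<odot> h = h \<odot> Some 0"
  shows "b = 0"
proof (cases "h = one1")
  case True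
  with eq show ?thesis
    by (simp add: one1_identity Some_in_S1)
next
  case False
  with assms(1) obtain g where "h = Some g" "g \<in> PP b"
    by (auto simp: PP1_def)
  \<comment> \<open>Here \<open>eq\<close> reads b * g = g * 0 = 0.\<close>
  with eq PP_mult_nonzero show ?thesis by fastforce
qed

theorem lemma2p3:
  shows "conj_class (0::'a::{semigroup_mult, mult_zero}) = {0}"
proof -
  \<comment> \<open>The identity \<open>one1\<close> serves as both witnesses.\<close>
  have "(0::'a, 0) \<in> conj_c"
    by (auto simp: conj_c_def PP1_def one1_identity Some_in_S1)
  then show ?thesis
    using PP1_annihilator by (auto simp: conj_class_def conj_c_def)
qed

end
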